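(* There is a single total computable function $d:\mathbb{N}\to\mathbb{N}$ which satisfies, with $\delta_a:=d(a)$, $\delta_a\in\mathbf{M}\iff\varphi_a(\delta_a)\!\downarrow=1$ for every $a$, and such that the same $d$ satisfies, for every index $a$ and every oracle $X\subseteq\mathbb{N}$: $$\delta_a\in\mathbf{M}^X\iff\varphi^X_a(\delta_a)\!\downarrow=1,$$ and exactly one of the following holds: (i) $\varphi^X_a(\delta_a)\!\downarrow=1$; (ii) $\varphi^X_a(\delta_a)\!\downarrow\neq1$; (iii) $\varphi^X_a(\delta_a)\!\uparrow$; where (i) refutes soundness, (ii) refutes exhaustiveness and (iii) refutes totality of the adjudicator $\varphi^X_a$ over the $X$-standard domain. Hence for every oracle $X$, no $X$-computable adjudicator over the $X$-standard domain is simultaneously total, exhaustive, and sound.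
   Context: $(\varphi_e)_{e\in\mathbb{N}}$ is the standard acceptable numbering of the unary partial computable functions and $\mathbf{M}=\{p:\varphi_p(0)\!\downarrow=1\}$. For $X\subseteq\mathbb{N}$, $(\varphi^X_e)_{e\in\mathbb{N}}$ is the standard enumeration of the unary $X$-partial computable functions, where $e$ codes the text of an oracle program and does not depend on $X$. Put $\mathbf{M}^X=\{p:\varphi^X_p(0)\!\downarrow=1\}$; the $X$-standard domain is $(\mathbb{N},\mathbf{M}^X)$. An $X$-computable adjudicator is an index $a$ acting through $\varphi^X_a$; it annuls $p$ if $\varphi^X_a(p)\!\downarrow=1$. It is total if $\varphi^X_a(p)\!\downarrow$ for all $p$; exhaustive if it annuls every $p\in\mathbb{N}$; sound if $\varphi^X_a(p)\!\downarrow=1$ implies $p\notin\mathbf{M}^X$ for all $p$. *)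

theory Defs
  imports "HOL-Library.Nat_Bijection"
begin

text \<open>
  Texts of oracle programs are terms for the partial recursive functions with one additional
  basic operation, a query to the oracle. They carry no arity: a missing argument reads as 0 and
  a surplus argument is ignored, so that every term denotes a partial function.
\<close>

datatype oprog =
    Zero
  | Succ
  | Query
  | Proj nat
  | Comp oprog "oprog list"
  | PrimRec oprog oprog
  | Mu oprog

definition arg :: "nat \<Rightarrow> nat list \<Rightarrow> nat" where
  "arg i xs = (if i < length xs then xs ! i else 0)"

text \<open>Unbounded search: every value tested before the first zero has to be defined.\<close>

definition search :: "(nat \<Rightarrow> nat option) \<Rightarrow> nat option" where
  "search f =
     (if \<exists>z. f z = Some 0 \<and> (\<forall>w<z. \<exists>v. f w = Some (Suc v))
      then Some (LEAST z. f z = Some 0) else None)"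

text \<open>
  The value \<open>None\<close> means divergence. The oracle argument \<open>orc\<close> is the (partial) function that
  answers queries; composition evaluates all of its arguments.
\<close>

primrec run :: "(nat \<Rightarrow> nat option) \<Rightarrow> oprog \<Rightarrow> nat list \<Rightarrow> nat option" where
  "run orc Zero = (\<lambda>xs. Some 0)"
| "run orc Succ = (\<lambda>xs. Some (Suc (arg 0 xs)))"
| "run orc Query = (\<lambda>xs. orc (arg 0 xs))"
| "run orc (Proj i) = (\<lambda>xs. Some (arg i xs))"
| "run orc (Comp f gs) =
     (\<lambda>xs. Option.bind (those (map (\<lambda>r. r xs) (map (run orc) gs))) (run orc f))"
| "run orc (PrimRec f g) =
     (\<lambda>xs. rec_nat (run orc f (tl xs))
             (\<lambda>k r. Option.bind r (\<lambda>v. run orc g (k # v # tl xs)))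
             (arg 0 xs))"
| "run orc (Mu f) = (\<lambda>xs. search (\<lambda>z. run orc f (z # xs)))"

primrec encode :: "oprog \<Rightarrow> nat" where
  "encode Zero = 0"
| "encode Succ = 1"
| "encode Query = 2"
| "encode (Proj i) = 3 + 4 * i"
| "encode (Comp f gs) = 4 + 4 * prod_encode (encode f, list_encode (map encode gs))"
| "encode (PrimRec f g) = 5 + 4 * prod_encode (encode f, encode g)"
| "encode (Mu f) = 6 + 4 * encode f"

lemma encode_inject: "encode p = encode q \<Longrightarrow> p = q"
proof (induction p arbitrary: q)
  case Zero
  then show ?case by (cases q) auto
next
  case Succ
  then show ?case by (cases q; auto; presburger)
next
  case Query
  then show ?case by (cases q; auto; presburger)
next
  case (Proj i)
  then show ?case by (cases q; auto; presburger)
next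
  case (Comp f gs)
  show ?case
  proof (cases q)
    case q: (Comp f' gs')
    have "f = f'" using Comp q by auto
    moreover have eq: "map encode gs = map encode gs'" using Comp.prems q by (auto simp: list_encode_eq)
    have "gs = gs'"
    proof (rule nth_equalityI)
      show len: "length gs = length gs'" using eq by (rule map_eq_imp_length_eq)
      fix i assume i: "i < length gs"
      then have "encode (gs ! i) = encode (gs' ! i)" using eq len by (metis nth_map)
      then show "gs ! i = gs' ! i" using Comp.IH(2) i by auto
    qed
    ultimately show ?thesis using q by simp
  qed (use Comp.prems in \<open>(simp; presburger)+\<close>)
next
  case (PrimRec f g)
  then show ?case by (cases q; auto; presburger)
next
  case (Mu f)
  then show ?case by (cases q; auto; presburger)
qed

lemma encode_surj: "\<exists>p. encode p = n"
proof (induction n rule: less_induct)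
  case (less n)
  consider "n = 0" | "n = 1" | "n = 2" | i where "n = 3 + 4 * i" | i where "n = 4 + 4 * i"
    | i where "n = 5 + 4 * i" | i where "n = 6 + 4 * i"
  proof -
    have "n = 0 \<or> n = 1 \<or> n = 2 \<or> (\<exists>i. n = 3 + 4 * i) \<or> (\<exists>i. n = 4 + 4 * i)
      \<or> (\<exists>i. n = 5 + 4 * i) \<or> (\<exists>i. n = 6 + 4 * i)" by presburger
    then show thesis using that by blast
  qed
  then show ?case
  proof cases
    case 1 then show ?thesis by (intro exI[of _ Zero]) simp
  next
    case 2 then show ?thesis by (intro exI[of _ Succ]) simp
  next
    case 3 then show ?thesis by (intro exI[of _ Query]) simp
  next
    case (4 i) then show ?thesis by (intro exI[of _ "Proj i"]) simp
  next
    case (5 i)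
    obtain x y where xy: "i = prod_encode (x, y)" by (metis prod.exhaust prod_decode_inverse)
    obtain xs where xs: "y = list_encode xs" by (metis list_decode_inverse)
    have el: "z \<le> list_encode zs" if "z \<in> set zs" for z :: nat and zs
      using that
    proof (induction zs)
      case (Cons w zs)
      then show ?case
        using le_prod_encode_1[of w "list_encode zs"] le_prod_encode_2[of "list_encode zs" w]
        by auto
    qed simp
    have "x \<le> i" "y \<le> i" using xy le_prod_encode_1 le_prod_encode_2 by auto
    then have "x < n" "\<forall>z\<in>set xs. z < n" using el[of _ xs] xs 5 by force+
    then have "\<exists>p. encode p = x" "\<forall>z\<in>set xs. \<exists>p. encode p = z" using less.IH by auto
    then obtain p g where "encode p = x" "\<forall>z\<in>set xs. encode (g z) = z" by metis
    then have "encode (Comp p (map g xs)) = n"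
      using 5 xy xs by (simp add: comp_def map_idI)
    then show ?thesis by blast
  next
    case (6 i)
    obtain x y where xy: "i = prod_encode (x, y)" by (metis prod.exhaust prod_decode_inverse)
    have "x \<le> i" "y \<le> i" using xy le_prod_encode_1 le_prod_encode_2 by auto
    then have "x < n" "y < n" using 6 by auto
    then obtain p q where "encode p = x" "encode q = y" using less.IH by metis
    then have "encode (PrimRec p q) = n" using 6 xy by simp
    then show ?thesis by blast
  next
    case (7 i)
    then obtain p where "encode p = i" using less.IH[of i] by auto
    then have "encode (Mu p) = n" using 7 by simp
    then show ?thesis by blast
  qed
qed

lemma bij_encode: "bij encode"
proof (rule bijI)
  show "inj encode" by (rule injI) (rule encode_inject)
  show "surj encode" using encode_surj by (metis surjI)
qed

definition decode :: "nat \<Rightarrow> oprog" where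
  "decode = inv encode"

text \<open>
  In the unrelativised numbering no oracle is present and a query diverges. In both numberings
  an index is decoded to the same text, independently of any oracle.
\<close>

definition phi :: "nat \<Rightarrow> nat \<Rightarrow> nat option" where
  "phi e x = run (\<lambda>_. None) (decode e) [x]"

definition phi_rel :: "nat set \<Rightarrow> nat \<Rightarrow> nat \<Rightarrow> nat option" where
  "phi_rel X e x = run (\<lambda>n. Some (if n \<in> X then 1 else 0)) (decode e) [x]"

definition total_computable :: "(nat \<Rightarrow> nat) \<Rightarrow> bool" where
  "total_computable f \<longleftrightarrow> (\<exists>e. \<forall>n. phi e n = Some (f n))"

definition M :: "nat set" where
  "M = {p. phi p 0 = Some 1}"

definition M_rel :: "nat set \<Rightarrow> nat set" where
  "M_rel X = {p. phi_rel X p 0 = Some 1}"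

definition annuls :: "nat set \<Rightarrow> nat \<Rightarrow> nat \<Rightarrow> bool" where
  "annuls X a p \<longleftrightarrow> phi_rel X a p = Some 1"

definition total_adj :: "nat set \<Rightarrow> nat \<Rightarrow> bool" where
  "total_adj X a \<longleftrightarrow> (\<forall>p. phi_rel X a p \<noteq> None)"

definition exhaustive_adj :: "nat set \<Rightarrow> nat \<Rightarrow> bool" where
  "exhaustive_adj X a \<longleftrightarrow> (\<forall>p. annuls X a p)"

definition sound_adj :: "nat set \<Rightarrow> nat \<Rightarrow> bool" where
  "sound_adj X a \<longleftrightarrow> (\<forall>p. annuls X a p \<longrightarrow> p \<notin> M_rel X)"

end

theory Submission
  imports Defs
begin

text \<open>
  The fixed point is built syntactically, so that no universal program is needed. Let \<open>D\<close> be a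
  query-free program that maps the code of a text \<open>p\<close> to the code of the text
  ``apply \<open>p\<close> to the code of \<open>p\<close>''. For an index \<open>a\<close> let \<open>h\<close> be the code of the composition of
  program \<open>a\<close> with \<open>D\<close>, and let \<open>d a = D(h)\<close>. On any input and with any oracle, the text with
  code \<open>d a\<close> runs program \<open>a\<close> on \<open>D(h)\<close>, that is, on \<open>d a\<close> itself. As \<open>D\<close> asks no queries, the
  same \<open>d\<close> serves the unrelativised numbering and all oracles.
\<close>

lemma arg_Cons_0 [simp]: "arg 0 (x # xs) = x"
  by (simp add: arg_def)

lemma arg_Cons_Suc [simp]: "arg (Suc i) (x # xs) = arg i xs"
  by (simp add: arg_def)

lemma arg_tl [simp]: "arg i (tl xs) = arg (Suc i) xs"
  by (cases xs) (simp_all add: arg_def)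

text \<open>Texts have no numerals beyond \<open>Zero\<close>; iterated successors let a code occur
  inside a text.\<close>

primrec const_prog :: "nat \<Rightarrow> oprog" where
  "const_prog 0 = Zero"
| "const_prog (Suc n) = Comp Succ [const_prog n]"

lemma run_const_prog [simp]: "run orc (const_prog n) xs = Some n"
  by (induction n) simp_all

definition add_prog :: oprog where
  "add_prog = PrimRec (Proj 0) (Comp Succ [Proj 1])"

lemma run_add_prog [simp]: "run orc add_prog xs = Some (arg 0 xs + arg 1 xs)"
proof -
  have "rec_nat (Some m) (\<lambda>k r. Option.bind r (\<lambda>v. Some (Suc v))) n = Some (n + m)" for m n :: nat
    by (induction n) simp_all
  then show ?thesis
    by (simp add: add_prog_def)
qed

text \<open>The step receives counter \<open>k\<close> and previous value \<open>v\<close>, and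
  \<open>triangle (Suc k) = Suc (k + triangle k)\<close>.\<close>

definition triangle_prog :: oprog where
  "triangle_prog = PrimRec Zero (Comp Succ [add_prog])"

lemma run_triangle_prog [simp]: "run orc triangle_prog xs = Some (triangle (arg 0 xs))"
proof -
  have "rec_nat (Some 0) (\<lambda>k r. Option.bind r (\<lambda>v. Some (Suc (k + v)))) n = Some (triangle n)" for n
    by (induction n) simp_all
  then show ?thesis
    by (simp add: triangle_prog_def)
qed

definition pair_prog :: oprog where
  "pair_prog = Comp add_prog [Comp triangle_prog [add_prog], Proj 0]"

lemma run_pair_prog [simp]: "run orc pair_prog xs = Some (prod_encode (arg 0 xs, arg 1 xs))"
  by (simp add: pair_prog_def prod_encode_def)

text \<open>Composition with one inner text, acting on codes, so that programs can compute
  it.\<close>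

definition comp_code :: "nat \<Rightarrow> nat \<Rightarrow> nat" where
  "comp_code m n = 4 + 4 * prod_encode (m, list_encode [n])"

lemma encode_Comp_singleton: "encode (Comp p [q]) = comp_code (encode p) (encode q)"
  by (simp add: comp_code_def)

definition double_prog :: oprog where
  "double_prog = Comp add_prog [Proj 0, Proj 0]"

lemma run_double_prog [simp]: "run orc double_prog xs = Some (2 * arg 0 xs)"
  by (simp add: double_prog_def)

text \<open>Uses \<open>4 + 4 * x = 2 * (2 * Suc x)\<close> and
  \<open>list_encode [n] = Suc (prod_encode (n, 0))\<close>.\<close>

definition comp_code_prog :: oprog where
  "comp_code_prog =
     Comp double_prog [Comp double_prog [Comp Succ
       [Comp pair_prog [Proj 0, Comp Succ [Comp pair_prog [Proj 1, Zero]]]]]]"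

lemma run_comp_code_prog [simp]:
  "run orc comp_code_prog xs = Some (comp_code (arg 0 xs) (arg 1 xs))"
  by (simp add: comp_code_prog_def comp_code_def)

text \<open>The self-applied text contains its own code as a numeral, so the code of that numeral
  must be computable. The start value 0 is \<open>encode Zero\<close>.\<close>

definition const_code_prog :: oprog where
  "const_code_prog = PrimRec Zero (Comp comp_code_prog [const_prog (encode Succ), Proj 1])"

lemma run_const_code_prog [simp]:
  "run orc const_code_prog xs = Some (encode (const_prog (arg 0 xs)))"
proof -
  have "rec_nat (Some 0) (\<lambda>k r. Option.bind r (\<lambda>v. Some (comp_code (encode Succ) v))) n
      = Some (encode (const_prog n))" for n
    by (induction n) (simp_all add: encode_Comp_singleton del: encode.simps(2,5))
  then show ?thesis
    by (simp add: const_code_prog_def)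
qed

definition diag_prog :: oprog where
  "diag_prog = Comp comp_code_prog [Proj 0, const_code_prog]"

lemma run_diag_prog:
  "run orc diag_prog xs = Some (comp_code (arg 0 xs) (encode (const_prog (arg 0 xs))))"
  by (simp add: diag_prog_def)

definition self_apply :: "oprog \<Rightarrow> oprog" where
  "self_apply p = Comp p [const_prog (encode p)]"

lemma run_self_apply: "run orc (self_apply p) xs = run orc p [encode p]"
  by (simp add: self_apply_def)

lemma run_diag_prog_encode: "arg 0 xs = encode p \<Longrightarrow> run orc diag_prog xs = Some (encode (self_apply p))"
  by (simp add: run_diag_prog self_apply_def encode_Comp_singleton del: encode.simps)

lemma decode_encode [simp]: "decode (encode p) = p"
  by (simp add: decode_def bij_encode bij_is_inj)

lemma encode_decode [simp]: "encode (decode n) = n"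
  by (simp add: decode_def bij_encode bij_is_surj surj_f_inv_f)

definition fixpoint :: "nat \<Rightarrow> nat" where
  "fixpoint a = encode (self_apply (Comp (decode a) [diag_prog]))"

text \<open>Self-application discards \<open>xs\<close> and feeds \<open>diag_prog\<close> the code
  of the composed text; its output there is \<open>fixpoint a\<close> by definition.\<close>

lemma run_fixpoint: "run orc (decode (fixpoint a)) xs = run orc (decode a) [fixpoint a]"
  by (simp add: fixpoint_def run_self_apply run_diag_prog_encode del: encode.simps)

text \<open>Since \<open>a = encode (decode a)\<close>, the inner part turns input \<open>a\<close>
  into the code of \<open>Comp (decode a) [diag_prog]\<close>.\<close>

definition fixpoint_prog :: oprog where
  "fixpoint_prog =
     Comp diag_prog [Comp comp_code_prog [Proj 0, const_prog (encode diag_prog)]]"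

lemma total_computable_fixpoint: "total_computable fixpoint"
proof -
  have "phi (encode fixpoint_prog) n = Some (fixpoint n)" for n
    unfolding phi_def fixpoint_prog_def fixpoint_def decode_encode
    by (simp add: run_diag_prog_encode encode_Comp_singleton del: encode.simps)
  then show ?thesis
    unfolding total_computable_def by blast
qed

lemma phi_fixpoint: "phi (fixpoint a) x = phi a (fixpoint a)"
  by (simp add: phi_def run_fixpoint)

lemma phi_rel_fixpoint: "phi_rel X (fixpoint a) x = phi_rel X a (fixpoint a)"
  by (simp add: phi_rel_def run_fixpoint)

lemma fixpoint_in_M_rel: "fixpoint a \<in> M_rel X \<longleftrightarrow> annuls X a (fixpoint a)"
  by (simp add: M_rel_def annuls_def phi_rel_fixpoint)

lemma not_sound_adj: "annuls X a (fixpoint a) \<Longrightarrow> \<not> sound_adj X a"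
  by (auto simp: sound_adj_def fixpoint_in_M_rel)

theorem corollary3p6:
  "(\<exists>d :: nat \<Rightarrow> nat. total_computable d \<and>
      (\<forall>a. d a \<in> M \<longleftrightarrow> phi a (d a) = Some 1) \<and>
      (\<forall>a X.
         (d a \<in> M_rel X \<longleftrightarrow> phi_rel X a (d a) = Some 1) \<and>
         (let c1 = (phi_rel X a (d a) = Some 1);
              c2 = (\<exists>v. phi_rel X a (d a) = Some v \<and> v \<noteq> 1);
              c3 = (phi_rel X a (d a) = None)
          in (c1 \<or> c2 \<or> c3) \<and> \<not> (c1 \<and> c2) \<and> \<not> (c1 \<and> c3) \<and> \<not> (c2 \<and> c3) \<and>
             (c1 \<longrightarrow> \<not> sound_adj X a) \<and>
             (c2 \<longrightarrow> \<not> exhaustive_adj X a) \<and>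
             (c3 \<longrightarrow> \<not> total_adj X a)))) \<and>
   (\<forall>X. \<not> (\<exists>a. total_adj X a \<and> exhaustive_adj X a \<and> sound_adj X a))"
proof (intro conjI allI exI[of _ fixpoint])
  show "total_computable fixpoint"
    by (rule total_computable_fixpoint)
  show "fixpoint a \<in> M \<longleftrightarrow> phi a (fixpoint a) = Some 1" for a
    by (simp add: M_def phi_fixpoint)
  show "fixpoint a \<in> M_rel X \<longleftrightarrow> phi_rel X a (fixpoint a) = Some 1" for a X
    by (simp add: fixpoint_in_M_rel annuls_def)
  show "let c1 = (phi_rel X a (fixpoint a) = Some 1);
            c2 = (\<exists>v. phi_rel X a (fixpoint a) = Some v \<and> v \<noteq> 1);
            c3 = (phi_rel X a (fixpoint a) = None)
        in (c1 \<or> c2 \<or> c3) \<and> \<not> (c1 \<and> c2) \<and> \<not> (c1 \<and> c3) \<and> \<not> (c2 \<and> c3) \<and>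
           (c1 \<longrightarrow> \<not> sound_adj X a) \<and>
           (c2 \<longrightarrow> \<not> exhaustive_adj X a) \<and>
           (c3 \<longrightarrow> \<not> total_adj X a)" for a X
    using not_sound_adj[of X a]
    \<comment> \<open>The fixed point itself is the input at which exhaustiveness or totality
      fails.\<close>
    by (cases "phi_rel X a (fixpoint a)")
      (auto simp: Let_def annuls_def exhaustive_adj_def total_adj_def
        intro!: exI[of _ "fixpoint a"])
  show "\<not> (\<exists>a. total_adj X a \<and> exhaustive_adj X a \<and> sound_adj X a)" for X
    \<comment> \<open>Exhaustiveness annuls the fixed point, which contradicts soundness.\<close>
    using not_sound_adj by (auto simp: exhaustive_adj_def)
qed

end
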